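(* Let $I$ be an infinite set, $\beta : I \to I$, $G : \mathcal{P}_{\omega,*}(I) \to \mathcal{P}_{\omega,*}(I)$ and $v : \mathcal{P}_{\omega,*}(I) \to I$. Then $P_1(\beta,G,v)$ holds if and only if there exist three functions $H, \overline{H}, \widetilde{H} : \mathcal{P}_{\omega,*}(I) \to \mathcal{P}_{\omega}(I)$ such that for all $I^* \in \mathcal{P}_{\omega,*}(I)$: $I^* \subseteq H(I^* ) \cup \overline{H}(I^* ) \cup \widetilde{H}(I^* )$, $H(I^* ) \subseteq \{a \in I : |\mathcal{O}^+_\beta(a)| = +\infty\}$, $\overline{H}(I^* ) , \widetilde{H}(I^* ) \subseteq \{a \in I : |\mathcal{O}^+_\beta(a)| < +\infty\}$, and one of the following holds: (a) $\exists z \in G(I^* ) : |\mathcal{O}^+_\beta(z)| = +\infty$, and $$H(I^* ) \neq \emptyset, \quad \overline{H}(I^* ) = \emptyset,$$ $$G(I^* ) = \Big( \bigcup_{a \in \widetilde{H}(I^* )} \mathcal{O}^+_\beta(a) \Big) \cup \Big( \bigcup_{a \in H(I^* )} \{a, \beta(a), \beta^2(a), \dots, \xi_\beta(H(I^* ))\} \Big),$$ $$v(I^* ) = \xi_\beta(H(I^* ));$$ (b) $\forall a \in G(I^* ) : |\mathcal{O}^+_\beta(a)| < +\infty$, and $$H(I^* ) = \emptyset, \quad \overline{H}(I^* ) \neq \emptyset,$$ $$G(I^* ) = \Big( \bigcup_{a \in \widetilde{H}(I^* )} \mathcal{O}^+_\beta(a) \Big) \cup \Big( \bigcup_{a \in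 \overline{H}(I^* )} \{a, \beta(a), \beta^2(a), \dots, v(I^* )\} \Big).$$
   Context: $\mathcal{P}_{\omega}(I)$ (resp. $\mathcal{P}_{\omega,*}(I)$) is the set of finite (resp. finite non-empty) subsets of $I$. $\mathbb{N} = \{0,1,2,\dots\}$. For a self-map $\phi$ of $I$ and $a \in I$, $\mathcal{O}^+_\phi(a) = \{\phi^n(a) : n \in \mathbb{N}\}$ (with $\phi^0 = \mathrm{Id}$). Property $P_1(\phi,G,u)$, for $\phi : I \to I$, $G : \mathcal{P}_{\omega,*}(I) \to \mathcal{P}_{\omega,*}(I)$, $u : \mathcal{P}_{\omega,*}(I) \to I$: for all $I^* \in \mathcal{P}_{\omega,*}(I)$, $u(I^* ) \in G(I^* )$, $I^* \subseteq G(I^* )$ and $\phi(G(I^* ) \setminus \{u(I^* )\}) \subseteq G(I^* )$. The map $\xi_\phi$: let $D_\phi = \{I^* \in \mathcal{P}_{\omega,*}(I) : \bigcap_{a \in I^*} \mathcal{O}^+_\phi(a) \neq \emptyset\}$. For $I^* \in D_\phi$, $z \in \bigcap_{a \in I^*} \mathcal{O}^+_\phi(a)$ and $a \in I^*$, put $m^z_a = \min\{m \in \mathbb{N} : \phi^m(a) = z\}$. Then $\xi_\phi : D_\phi \to I$ is a (fixed, possibly non-canonical) map selecting for each $I^* \in D_\phi$ an element $\xi_\phi(I^* ) \in \bigcap_{a \in I^*} \mathcal{O}^+_\phi(a)$ for which $\sum_{a \in I^*} m^{\xi_\phi(I^* )}_a$ is minimal. For $z \in \mathcal{O}^+_\beta(a)$,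 $\{a, \beta(a), \beta^2(a), \dots, z\}$ denotes $\{\beta^i(a) : 0 \le i \le m\}$ with $m = \min\{m \in \mathbb{N} : \beta^m(a) = z\}$. Writing this set in the conditions (a), (b) includes the requirement that $z$ belongs to $\mathcal{O}^+_\beta(a)$; in particular (a) includes $H(I^* ) \in D_\beta$, and (b) includes $v(I^* ) \in \mathcal{O}^+_\beta(a)$ for all $a \in \overline{H}(I^* )$. *)

theory Defs
  imports Main "HOL-Library.FuncSet"
begin

definition Pfin :: "'a set \<Rightarrow> 'a set set" where
  "Pfin I = {A. A \<subseteq> I \<and> finite A}"

definition Pfin_ne :: "'a set \<Rightarrow> 'a set set" where
  "Pfin_ne I = {A. A \<subseteq> I \<and> finite A \<and> A \<noteq> {}}"

text \<open>The forward orbit contains its starting point, unlike the constant \<open>orbit\<close> of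
  HOL-Combinatorics, which only collects the iterates with positive exponent.\<close>

definition forward_orbit :: "('a \<Rightarrow> 'a) \<Rightarrow> 'a \<Rightarrow> 'a set" where
  "forward_orbit \<phi> a = {(\<phi> ^^ n) a | n. True}"

definition P1 :: "'a set \<Rightarrow> ('a \<Rightarrow> 'a) \<Rightarrow> ('a set \<Rightarrow> 'a set) \<Rightarrow> ('a set \<Rightarrow> 'a) \<Rightarrow> bool" where
  "P1 I \<phi> G u \<longleftrightarrow>
     (\<forall>A \<in> Pfin_ne I. u A \<in> G A \<and> A \<subseteq> G A \<and> \<phi> ` (G A - {u A}) \<subseteq> G A)"

text \<open>The next two notions are meaningful only for \<open>z \<in> forward_orbit \<phi> a\<close>.\<close>

definition hitting_time :: "('a \<Rightarrow> 'a) \<Rightarrow> 'a \<Rightarrow> 'a \<Rightarrow> nat" where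
  "hitting_time \<phi> a z = (LEAST m. (\<phi> ^^ m) a = z)"

definition orbit_segment :: "('a \<Rightarrow> 'a) \<Rightarrow> 'a \<Rightarrow> 'a \<Rightarrow> 'a set" where
  "orbit_segment \<phi> a z = {(\<phi> ^^ i) a | i. i \<le> hitting_time \<phi> a z}"

definition common_orbit_sets :: "'a set \<Rightarrow> ('a \<Rightarrow> 'a) \<Rightarrow> 'a set set" where
  "common_orbit_sets I \<phi> = {A \<in> Pfin_ne I. (\<Inter>a\<in>A. forward_orbit \<phi> a) \<noteq> {}}"

text \<open>The minimising common point need not be unique, so \<open>\<xi>\<close> is any function selecting one.
  Its values outside \<open>common_orbit_sets I \<phi>\<close> are unconstrained.\<close>

definition is_xi :: "'a set \<Rightarrow> ('a \<Rightarrow> 'a) \<Rightarrow> ('a set \<Rightarrow> 'a) \<Rightarrow> bool" where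
  "is_xi I \<phi> \<xi> \<longleftrightarrow>
     (\<forall>A \<in> common_orbit_sets I \<phi>.
        \<xi> A \<in> (\<Inter>a\<in>A. forward_orbit \<phi> a) \<and>
        (\<forall>z \<in> (\<Inter>a\<in>A. forward_orbit \<phi> a).
           (\<Sum>a\<in>A. hitting_time \<phi> a (\<xi> A)) \<le> (\<Sum>a\<in>A. hitting_time \<phi> a z)))"

lemma is_xi_exists: "\<exists>\<xi>. is_xi I \<phi> \<xi>"
proof -
  have "\<exists>x. x \<in> (\<Inter>a\<in>A. forward_orbit \<phi> a) \<and>
        (\<forall>z \<in> (\<Inter>a\<in>A. forward_orbit \<phi> a).
           (\<Sum>a\<in>A. hitting_time \<phi> a x) \<le> (\<Sum>a\<in>A. hitting_time \<phi> a z))"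
    if A: "A \<in> common_orbit_sets I \<phi>" for A
  proof -
    from A obtain y where "y \<in> (\<Inter>a\<in>A. forward_orbit \<phi> a)"
      unfolding common_orbit_sets_def by blast
    from ex_has_least_nat[of "\<lambda>x. x \<in> (\<Inter>a\<in>A. forward_orbit \<phi> a)", OF this,
        of "\<lambda>x. \<Sum>a\<in>A. hitting_time \<phi> a x"]
    show ?thesis by blast
  qed
  then show ?thesis
    unfolding is_xi_def by (intro bchoice ballI)
qed

end

theory Submission
  imports Defs
begin

text \<open>
  A finite set \<open>S\<close> that is stable under \<open>\<phi>\<close> except possibly at \<open>v\<close> contains, for each of its
  elements \<open>a\<close>, the segment from \<open>a\<close> to \<open>v\<close> if the orbit of \<open>a\<close> meets \<open>v\<close>, and the whole orbit of
  \<open>a\<close> otherwise. Infinite orbits do not fit into \<open>S\<close>, so they all meet \<open>v\<close>. Whether the orbit of a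
  point is infinite does not change along its orbit, so if \<open>S\<close> contains a point with infinite orbit
  then \<open>v\<close> is one as well, and no finite orbit meets \<open>v\<close>. In this case \<open>v\<close> lies in the set \<open>H\<close> of
  points of \<open>S\<close> with infinite orbit, hence each common point of the orbits of \<open>H\<close> lies on the orbit
  of \<open>v\<close>; being \<open>k\<close> steps beyond \<open>v\<close> costs \<open>k\<close> in every hitting time, and \<open>v\<close> is the unique minimiser.
\<close>

section \<open>Forward orbits and segments, and their containment in sets stable off one
  point\<close>

lemma self_in_forward_orbit: "a \<in> forward_orbit \<phi> a"
  unfolding forward_orbit_def by (auto intro: exI[of _ 0])

lemma forward_orbit_step:
  assumes "x \<in> forward_orbit \<phi> a"
  shows "\<phi> x \<in> forward_orbit \<phi> a"
proof -
  obtain n where "x = (\<phi> ^^ n) a"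
    using assms unfolding forward_orbit_def by blast
  then have "\<phi> x = (\<phi> ^^ Suc n) a" by simp
  then show ?thesis unfolding forward_orbit_def by blast
qed

lemma self_in_orbit_segment: "a \<in> orbit_segment \<phi> a z"
  unfolding orbit_segment_def by (auto intro: exI[of _ 0])

lemma funpow_hitting_time:
  assumes "z \<in> forward_orbit \<phi> a"
  shows "(\<phi> ^^ hitting_time \<phi> a z) a = z"
  using assms unfolding forward_orbit_def hitting_time_def by (auto intro: LeastI)

lemma end_in_orbit_segment:
  assumes "z \<in> forward_orbit \<phi> a"
  shows "z \<in> orbit_segment \<phi> a z"
proof -
  have "z = (\<phi> ^^ hitting_time \<phi> a z) a"
    using funpow_hitting_time[OF assms] by simp
  then show ?thesis unfolding orbit_segment_def by blast
qed

lemma orbit_segment_step: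
  assumes "z \<in> forward_orbit \<phi> a" "x \<in> orbit_segment \<phi> a z" "x \<noteq> z"
  shows "\<phi> x \<in> orbit_segment \<phi> a z"
proof -
  obtain i where i: "x = (\<phi> ^^ i) a" "i \<le> hitting_time \<phi> a z"
    using assms(2) unfolding orbit_segment_def by blast
  \<comment> \<open>The iterate at the last index is \<open>z\<close>, so
    \<open>x \<noteq> z\<close> leaves room for one more step.\<close>
  then have "i \<noteq> hitting_time \<phi> a z"
    using funpow_hitting_time[OF assms(1)] assms(3) by auto
  then have "Suc i \<le> hitting_time \<phi> a z" "\<phi> x = (\<phi> ^^ Suc i) a"
    using i by auto
  then show ?thesis unfolding orbit_segment_def by blast
qed

lemma orbit_segment_subset:
  assumes "\<phi> ` (S - {v}) \<subseteq> S" "a \<in> S"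
  shows "orbit_segment \<phi> a v \<subseteq> S"
proof -
  have "(\<phi> ^^ i) a \<in> S" if "i \<le> hitting_time \<phi> a v" for i
    using that
  proof (induction i)
    case 0
    show ?case using assms(2) by simp
  next
    case (Suc i)
    \<comment> \<open>Minimality of the hitting time: the exceptional point is not met at any
      earlier index.\<close>
    then have "(\<phi> ^^ i) a \<noteq> v"
      using not_less_Least[of i "\<lambda>m. (\<phi> ^^ m) a = v"] unfolding hitting_time_def by auto
    with Suc assms(1) show ?case by auto
  qed
  then show ?thesis unfolding orbit_segment_def by blast
qed

lemma forward_orbit_subset:
  assumes "\<phi> ` (S - {v}) \<subseteq> S" "a \<in> S" "v \<notin> forward_orbit \<phi> a"
  shows "forward_orbit \<phi> a \<subseteq> S"
proof -
  have "(\<phi> ^^ i) a \<in> S" for i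
  proof (induction i)
    case 0
    show ?case using assms(2) by simp
  next
    case (Suc i)
    have "(\<phi> ^^ i) a \<noteq> v"
      using assms(3) unfolding forward_orbit_def by blast
    with Suc assms(1) show ?case by auto
  qed
  then show ?thesis unfolding forward_orbit_def by blast
qed

section \<open>Finite and infinite orbits\<close>

lemma finite_forward_orbit_iff:
  assumes "z \<in> forward_orbit \<phi> a"
  shows "finite (forward_orbit \<phi> z) \<longleftrightarrow> finite (forward_orbit \<phi> a)"
proof -
  obtain m where m: "z = (\<phi> ^^ m) a"
    using assms unfolding forward_orbit_def by blast
  \<comment> \<open>Seen from \<open>a\<close>, the orbit of \<open>z\<close> is the tail from index
    \<open>m\<close> on, so the two orbits differ by at most \<open>m\<close> points.\<close>
  have "forward_orbit \<phi> z = (\<lambda>n. (\<phi> ^^ n) a) ` {m..}"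
  proof -
    have "range (\<lambda>n. n + m) = {m..}"
      by (auto intro: le_add_diff_inverse2[symmetric])
    moreover have "forward_orbit \<phi> z = (\<lambda>n. (\<phi> ^^ n) a) ` range (\<lambda>n. n + m)"
      unfolding forward_orbit_def m by (auto simp: funpow_add image_image)
    ultimately show ?thesis by simp
  qed
  moreover have "forward_orbit \<phi> a = (\<lambda>n. (\<phi> ^^ n) a) ` ({..<m} \<union> {m..})"
    unfolding forward_orbit_def by (auto simp: ivl_disj_un)
  ultimately have "forward_orbit \<phi> a = (\<lambda>n. (\<phi> ^^ n) a) ` {..<m} \<union> forward_orbit \<phi> z"
    by (simp only: image_Un)
  then show ?thesis by simp
qed

text \<open>A repetition at \<open>i < j\<close> makes the orbit periodic from \<open>i\<close> on
  and confines it to its first \<open>j\<close> iterates.\<close>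

lemma inj_funpow_if_infinite_forward_orbit:
  assumes "infinite (forward_orbit \<phi> a)"
  shows "inj (\<lambda>n. (\<phi> ^^ n) a)"
proof (rule linorder_injI)
  fix i j :: nat
  assume "i < j"
  show "(\<phi> ^^ i) a \<noteq> (\<phi> ^^ j) a"
  proof
    assume eq: "(\<phi> ^^ i) a = (\<phi> ^^ j) a"
    have "(\<phi> ^^ n) a \<in> (\<lambda>n. (\<phi> ^^ n) a) ` {..<j}" for n
    proof (induction n)
      case 0
      show ?case using \<open>i < j\<close> by (intro image_eqI[of _ _ 0]) auto
    next
      case (Suc n)
      then obtain m where m: "m < j" "(\<phi> ^^ Suc n) a = (\<phi> ^^ Suc m) a" by auto
      show ?case
      \<comment> \<open>An exponent that reaches \<open>j\<close> is folded back to
        \<open>i\<close>.\<close>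
      proof (cases "Suc m = j")
        case True
        then show ?thesis using m eq \<open>i < j\<close> by (intro image_eqI[of _ _ i]) auto
      next
        case False
        then show ?thesis using m by (intro image_eqI[of _ _ "Suc m"]) auto
      qed
    qed
    then have "forward_orbit \<phi> a \<subseteq> (\<lambda>n. (\<phi> ^^ n) a) ` {..<j}"
      unfolding forward_orbit_def by blast
    then show False using assms finite_surj by blast
  qed
qed

text \<open>By injectivity, \<open>n\<close> is the only exponent that leads from \<open>a\<close>
  to this point.\<close>

lemma hitting_time_funpow:
  assumes "infinite (forward_orbit \<phi> a)"
  shows "hitting_time \<phi> a ((\<phi> ^^ n) a) = n"
  unfolding hitting_time_def
  using injD[OF inj_funpow_if_infinite_forward_orbit[OF assms]]
  by (intro Least_equality) auto

lemma is_xi_eq_common_member: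
  assumes "is_xi I \<phi> \<xi>" "H \<in> common_orbit_sets I \<phi>" "v \<in> H"
    and v: "\<And>a. a \<in> H \<Longrightarrow> v \<in> forward_orbit \<phi> a"
    and inf: "\<And>a. a \<in> H \<Longrightarrow> infinite (forward_orbit \<phi> a)"
  shows "\<xi> H = v"
proof -
  have \<xi>: "\<xi> H \<in> forward_orbit \<phi> v"
    and le: "(\<Sum>a\<in>H. hitting_time \<phi> a (\<xi> H)) \<le> (\<Sum>a\<in>H. hitting_time \<phi> a v)"
    using assms unfolding is_xi_def by auto
  from \<xi> obtain k where k: "\<xi> H = (\<phi> ^^ k) v" unfolding forward_orbit_def by blast
  have "hitting_time \<phi> a (\<xi> H) = k + hitting_time \<phi> a v" if a: "a \<in> H" for a
  proof -
    have "\<xi> H = (\<phi> ^^ (k + hitting_time \<phi> a v)) a"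
      using k funpow_hitting_time[OF v[OF a]] by (simp add: funpow_add)
    then show ?thesis using hitting_time_funpow[OF inf[OF a]] by simp
  qed
  \<comment> \<open>Summed over \<open>H\<close>, the excess of \<open>\<xi> H\<close> over
    \<open>v\<close> is \<open>card H * k\<close>, which minimality forbids to be positive.\<close>
  then have "card H * k = 0"
    using le by (simp add: sum.distrib)
  moreover have "finite H" "H \<noteq> {}"
    using assms(2) unfolding common_orbit_sets_def Pfin_ne_def by auto
  ultimately have "k = 0" by simp
  then show ?thesis using k by simp
qed

section \<open>Unions of orbits and segments\<close>

lemma orbits_Un_segments_step:
  assumes "\<And>a. a \<in> H \<Longrightarrow> v \<in> forward_orbit \<phi> a"
    and "x \<in> (\<Union>a\<in>K. forward_orbit \<phi> a) \<union> (\<Union>a\<in>H. orbit_segment \<phi> a v)" "x \<noteq> v"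
  shows "\<phi> x \<in> (\<Union>a\<in>K. forward_orbit \<phi> a) \<union> (\<Union>a\<in>H. orbit_segment \<phi> a v)"
  \<comment> \<open>Whole orbits are stable, and a segment can be left only from its end
    \<open>v\<close>.\<close>
  using assms by (auto intro: forward_orbit_step orbit_segment_step)

text \<open>Serves both cases of the forward direction, which differ only in how \<open>S\<close> is
  split into \<open>H\<close> and \<open>K\<close>.\<close>

lemma eq_orbits_Un_segments:
  assumes "\<phi> ` (S - {v}) \<subseteq> S" "S = H \<union> K"
    and "\<And>a. a \<in> K \<Longrightarrow> v \<notin> forward_orbit \<phi> a"
  shows "S = (\<Union>a\<in>K. forward_orbit \<phi> a) \<union> (\<Union>a\<in>H. orbit_segment \<phi> a v)"
proof
  show "S \<subseteq> (\<Union>a\<in>K. forward_orbit \<phi> a) \<union> (\<Union>a\<in>H. orbit_segment \<phi> a v)"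
    using assms(2) self_in_forward_orbit self_in_orbit_segment by fast
  show "(\<Union>a\<in>K. forward_orbit \<phi> a) \<union> (\<Union>a\<in>H. orbit_segment \<phi> a v) \<subseteq> S"
    using forward_orbit_subset[OF assms(1)] orbit_segment_subset[OF assms(1)] assms(2,3)
    by blast
qed

theorem proposition7p1:
  fixes I :: "'a set"
    and \<beta> :: "'a \<Rightarrow> 'a"
    and G :: "'a set \<Rightarrow> 'a set"
    and v :: "'a set \<Rightarrow> 'a"
    and \<xi> :: "'a set \<Rightarrow> 'a"
  assumes "infinite I"
    and "\<beta> \<in> I \<rightarrow> I"
    and "G \<in> Pfin_ne I \<rightarrow> Pfin_ne I"
    and "v \<in> Pfin_ne I \<rightarrow> I"
    and "is_xi I \<beta> \<xi>"
  shows "P1 I \<beta> G v \<longleftrightarrow>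
    (\<exists>H \<in> Pfin_ne I \<rightarrow> Pfin I. \<exists>Hbar \<in> Pfin_ne I \<rightarrow> Pfin I. \<exists>Htilde \<in> Pfin_ne I \<rightarrow> Pfin I.
      \<forall>A \<in> Pfin_ne I.
        A \<subseteq> H A \<union> Hbar A \<union> Htilde A \<and>
        H A \<subseteq> {a \<in> I. infinite (forward_orbit \<beta> a)} \<and>
        Hbar A \<subseteq> {a \<in> I. finite (forward_orbit \<beta> a)} \<and>
        Htilde A \<subseteq> {a \<in> I. finite (forward_orbit \<beta> a)} \<and>
        (((\<exists>z \<in> G A. infinite (forward_orbit \<beta> z)) \<and>
          H A \<noteq> {} \<and> Hbar A = {} \<and>
          H A \<in> common_orbit_sets I \<beta> \<and>
          G A = (\<Union>a\<in>Htilde A. forward_orbit \<beta> a) \<union>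
                (\<Union>a\<in>H A. orbit_segment \<beta> a (\<xi> (H A))) \<and>
          v A = \<xi> (H A))
         \<or>
         ((\<forall>a \<in> G A. finite (forward_orbit \<beta> a)) \<and>
          H A = {} \<and> Hbar A \<noteq> {} \<and>
          (\<forall>a \<in> Hbar A. v A \<in> forward_orbit \<beta> a) \<and>
          G A = (\<Union>a\<in>Htilde A. forward_orbit \<beta> a) \<union>
                (\<Union>a\<in>Hbar A. orbit_segment \<beta> a (v A)))))"
    (is "_ \<longleftrightarrow> (\<exists>H \<in> _. \<exists>Hbar \<in> _. \<exists>Htilde \<in> _. \<forall>A \<in> _. ?Q A (H A) (Hbar A) (Htilde A))")
proof -
  \<comment> \<open>Keeps the long condition folded while quantifiers and choice are
    handled.\<close>
  define Q where "Q A H Hb K \<longleftrightarrow> ?Q A H Hb K" for A H Hb K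
  have "P1 I \<beta> G v \<longleftrightarrow> (\<exists>H \<in> Pfin_ne I \<rightarrow> Pfin I. \<exists>Hbar \<in> Pfin_ne I \<rightarrow> Pfin I.
    \<exists>Htilde \<in> Pfin_ne I \<rightarrow> Pfin I. \<forall>A \<in> Pfin_ne I. Q A (H A) (Hbar A) (Htilde A))"
  proof
    assume P1: "P1 I \<beta> G v"
    have ex: "\<exists>H \<in> Pfin I. \<exists>Hb \<in> Pfin I. \<exists>Ht \<in> Pfin I. Q A H Hb Ht" if A: "A \<in> Pfin_ne I" for A
    proof -
      have vG: "v A \<in> G A" and AG: "A \<subseteq> G A" and step: "\<beta> ` (G A - {v A}) \<subseteq> G A"
        using P1 A unfolding P1_def by auto
      have GI: "G A \<subseteq> I" and fin: "finite (G A)"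
        using assms(3) A unfolding Pfin_ne_def by auto
      have Pfin: "{a \<in> G A. P a} \<in> Pfin I" for P
        using GI fin unfolding Pfin_def by auto
      show ?thesis
      proof (cases "\<exists>z \<in> G A. infinite (forward_orbit \<beta> z)")
        case True
        define H where "H = {a \<in> G A. infinite (forward_orbit \<beta> a)}"
        define K where "K = {a \<in> G A. finite (forward_orbit \<beta> a)}"
        have hit: "v A \<in> forward_orbit \<beta> a" if "a \<in> H" for a
          using forward_orbit_subset[OF step, of a] that fin finite_subset unfolding H_def by blast
        have vinf: "infinite (forward_orbit \<beta> (v A))"
          using True hit finite_forward_orbit_iff[of "v A" \<beta>] unfolding H_def by blast
        then have vH: "v A \<in> H" using vG unfolding H_def by simp
        have common: "H \<in> common_orbit_sets I \<beta>"
          unfolding common_orbit_sets_def Pfin_ne_def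
          using vH hit GI fin by (auto simp: H_def)
        have "\<xi> H = v A"
          by (rule is_xi_eq_common_member[OF assms(5) common vH hit]) (auto simp: H_def)
        moreover have "G A = (\<Union>a\<in>K. forward_orbit \<beta> a) \<union> (\<Union>a\<in>H. orbit_segment \<beta> a (v A))"
          using vinf finite_forward_orbit_iff[of "v A" \<beta>]
          by (intro eq_orbits_Un_segments[OF step]) (auto simp: H_def K_def)
        moreover have "A \<subseteq> H \<union> {} \<union> K" "H \<subseteq> {a \<in> I. infinite (forward_orbit \<beta> a)}"
          "K \<subseteq> {a \<in> I. finite (forward_orbit \<beta> a)}"
          using AG GI by (auto simp: H_def K_def)
        ultimately have "Q A H {} K"
          unfolding Q_def using True vH common by (intro conjI disjI1) auto
        moreover have "H \<in> Pfin I" "K \<in> Pfin I" "{} \<in> Pfin I"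
          unfolding H_def K_def by (rule Pfin)+ (simp add: Pfin_def)
        ultimately show ?thesis by blast
      next
        case False
        \<comment> \<open>All orbits are finite here, so the split is by whether they meet
          \<open>v A\<close>; the point \<open>v A\<close> itself makes \<open>H\<close>
          nonempty.\<close>
        define H where "H = {a \<in> G A. v A \<in> forward_orbit \<beta> a}"
        define K where "K = {a \<in> G A. v A \<notin> forward_orbit \<beta> a}"
        have "G A = (\<Union>a\<in>K. forward_orbit \<beta> a) \<union> (\<Union>a\<in>H. orbit_segment \<beta> a (v A))"
          by (intro eq_orbits_Un_segments[OF step]) (auto simp: H_def K_def)
        moreover have "v A \<in> H" using vG self_in_forward_orbit unfolding H_def by simp
        moreover have "A \<subseteq> {} \<union> H \<union> K" "H \<subseteq> {a \<in> I. finite (forward_orbit \<beta> a)}"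
          "K \<subseteq> {a \<in> I. finite (forward_orbit \<beta> a)}" "\<forall>a \<in> H. v A \<in> forward_orbit \<beta> a"
          using False AG GI by (auto simp: H_def K_def)
        ultimately have "Q A {} H K"
          unfolding Q_def using False by (intro conjI disjI2) auto
        moreover have "H \<in> Pfin I" "K \<in> Pfin I" "{} \<in> Pfin I"
          unfolding H_def K_def by (rule Pfin)+ (simp add: Pfin_def)
        ultimately show ?thesis by blast
      qed
    qed
    \<comment> \<open>The three sets are packed into a triple, so that a single choice function
      \<open>p\<close> yields all three functions as its projections.\<close>
    have "\<forall>A \<in> Pfin_ne I. \<exists>p. p \<in> Pfin I \<times> Pfin I \<times> Pfin I \<and>
        Q A (fst p) (fst (snd p)) (snd (snd p))"
    proof
      fix A assume "A \<in> Pfin_ne I"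
      then obtain H Hb K where "H \<in> Pfin I" "Hb \<in> Pfin I" "K \<in> Pfin I" "Q A H Hb K"
        using ex by blast
      then show "\<exists>p. p \<in> Pfin I \<times> Pfin I \<times> Pfin I \<and> Q A (fst p) (fst (snd p)) (snd (snd p))"
        by (intro exI[of _ "(H, Hb, K)"]) simp
    qed
    then obtain p where p: "\<forall>A \<in> Pfin_ne I. p A \<in> Pfin I \<times> Pfin I \<times> Pfin I \<and>
        Q A (fst (p A)) (fst (snd (p A))) (snd (snd (p A)))"
      unfolding bchoice_iff by blast
    then have pI: "p A \<in> Pfin I \<times> Pfin I \<times> Pfin I" if "A \<in> Pfin_ne I" for A
      using that by blast
    show "\<exists>H \<in> Pfin_ne I \<rightarrow> Pfin I. \<exists>Hbar \<in> Pfin_ne I \<rightarrow> Pfin I. \<exists>Htilde \<in> Pfin_ne I \<rightarrow> Pfin I.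
        \<forall>A \<in> Pfin_ne I. Q A (H A) (Hbar A) (Htilde A)"
    proof (intro bexI)
      show "\<forall>A \<in> Pfin_ne I. Q A (fst (p A)) (fst (snd (p A))) (snd (snd (p A)))"
        using p by blast
    qed (use pI in \<open>auto simp: mem_Times_iff\<close>)
  next
    assume "\<exists>H \<in> Pfin_ne I \<rightarrow> Pfin I. \<exists>Hbar \<in> Pfin_ne I \<rightarrow> Pfin I. \<exists>Htilde \<in> Pfin_ne I \<rightarrow> Pfin I.
        \<forall>A \<in> Pfin_ne I. Q A (H A) (Hbar A) (Htilde A)"
    then have Q: "\<exists>H Hb K. Q A H Hb K" if "A \<in> Pfin_ne I" for A
      using that by blast
    have "v A \<in> G A \<and> A \<subseteq> G A \<and> \<beta> ` (G A - {v A}) \<subseteq> G A" if A: "A \<in> Pfin_ne I" for A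
    proof -
      obtain H Hb K where Q: "Q A H Hb K" using Q[OF A] by blast
      \<comment> \<open>Both alternatives take one form: \<open>L\<close> is \<open>H\<close> in the
        infinite case, where \<open>v A = \<xi> H\<close>, and \<open>Hb\<close> in the finite
        one.\<close>
      obtain L where AL: "A \<subseteq> L \<union> K" and ne: "L \<noteq> {}"
        and hit: "\<And>a. a \<in> L \<Longrightarrow> v A \<in> forward_orbit \<beta> a"
        and GA: "G A = (\<Union>a\<in>K. forward_orbit \<beta> a) \<union> (\<Union>a\<in>L. orbit_segment \<beta> a (v A))"
      proof (cases "H = {}")
        case True
        show thesis by (rule that[of Hb]) (use Q[unfolded Q_def] True in simp_all)
      next
        case False
        \<comment> \<open>Only this membership of the selected point is used; its minimality matters
          in the forward direction.\<close>
        have "\<xi> H \<in> (\<Inter>a\<in>H. forward_orbit \<beta> a)"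
          using Q False assms(5) unfolding is_xi_def Q_def by blast
        moreover have "Hb = {}" using Q False unfolding Q_def by blast
        ultimately show thesis
          by (intro that[of H]) (use Q[unfolded Q_def] False in simp_all)
      qed
      \<comment> \<open>Any element of the nonempty \<open>L\<close> starts a segment that ends in
        \<open>v A\<close>.\<close>
      have "v A \<in> G A"
        unfolding GA using ne hit end_in_orbit_segment by fast
      moreover have "A \<subseteq> G A"
        unfolding GA using AL self_in_forward_orbit self_in_orbit_segment by fast
      moreover have "\<beta> ` (G A - {v A}) \<subseteq> G A"
      proof
        fix y assume "y \<in> \<beta> ` (G A - {v A})"
        then obtain x where x: "x \<in> G A" "x \<noteq> v A" "y = \<beta> x" by blast
        show "y \<in> G A"
          unfolding GA x(3) by (rule orbits_Un_segments_step[OF hit x(1)[unfolded GA] x(2)])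
      qed
      ultimately show ?thesis by blast
    qed
    then show "P1 I \<beta> G v" unfolding P1_def by blast
  qed
  then show ?thesis unfolding Q_def .
qed

end
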